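(* Let $0<\alpha<1$. Then every graph $G$ contains a cycle of length at least $$\frac{1-\alpha}{16000}\cdot c_{\alpha}(G).$$
   Context: All graphs are finite and simple. For a graph $H$, $|H|$ denotes its number of vertices, $e(H)$ its number of edges and $d(H)=2e(H)/|H|$ its average degree. For $\alpha\in(0,1)$, a subgraph $H\subseteq G$ is an $\alpha$-crux of $G$ if $d(H)\ge \alpha\cdot d(G)$, and the $\alpha$-crux function of $G$ is $$c_{\alpha}(G)=\min\{ |H| : H\subseteq G \text{ and } d(H)\ge \alpha\cdot d(G)\},$$ the order of a smallest $\alpha$-crux of $G$.
   Formalization: The formal theorem assumes in addition that G contains at least one cycle (of length at least 3); without this the claim fails, since a forest such as K_2 has c_α(G) ≥ 1 but no cycle at all. *)

theory Defs
  imports Complex_Main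
begin

type_synonym 'a ugraph = "'a set \<times> 'a set set"

abbreviation verts :: "'a ugraph \<Rightarrow> 'a set" where
  "verts G \<equiv> fst G"

abbreviation edges :: "'a ugraph \<Rightarrow> 'a set set" where
  "edges G \<equiv> snd G"

definition simple_graph :: "'a ugraph \<Rightarrow> bool" where
  "simple_graph G \<longleftrightarrow> finite (verts G) \<and> (\<forall>e\<in>edges G. e \<subseteq> verts G \<and> card e = 2)"

text \<open>Subgraphs need not be induced.\<close>

definition subgraph :: "'a ugraph \<Rightarrow> 'a ugraph \<Rightarrow> bool" where
  "subgraph H G \<longleftrightarrow> simple_graph H \<and> verts H \<subseteq> verts G \<and> edges H \<subseteq> edges G"

definition avg_degree :: "'a ugraph \<Rightarrow> real" where
  "avg_degree G = 2 * real (card (edges G)) / real (card (verts G))"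

text \<open>
  The average degree is only meaningful for graphs with at least one vertex, hence the
  nonemptiness condition on \<open>H\<close>.
\<close>

definition is_crux :: "real \<Rightarrow> 'a ugraph \<Rightarrow> 'a ugraph \<Rightarrow> bool" where
  "is_crux \<alpha> G H \<longleftrightarrow>
     subgraph H G \<and> verts H \<noteq> {} \<and> avg_degree H \<ge> \<alpha> * avg_degree G"

definition crux :: "real \<Rightarrow> 'a ugraph \<Rightarrow> nat" where
  "crux \<alpha> G = Min {card (verts H) | H. is_crux \<alpha> G H}"

text \<open>
  A cycle is given by the cyclic sequence of its distinct vertices, so that its length
  (number of edges) is the length of the list.
\<close>

definition is_cycle :: "'a ugraph \<Rightarrow> 'a list \<Rightarrow> bool" where
  "is_cycle G C \<longleftrightarrow>
     length C \<ge> 3 \<and> distinct C \<and> set C \<subseteq> verts G \<and>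
     (\<forall>i<length C. {C ! i, C ! (Suc i mod length C)} \<in> edges G)"

text \<open>The minimum defining \<^const>\<open>crux\<close> is taken over a finite nonempty set.\<close>

lemma crux_orders_finite:
  assumes "simple_graph G"
  shows "finite {card (verts H) | H. is_crux \<alpha> G H}"
proof (rule finite_subset)
  show "{card (verts H) | H. is_crux \<alpha> G H} \<subseteq> {..card (verts G)}"
    using assms by (auto simp: is_crux_def subgraph_def simple_graph_def intro: card_mono)
qed simp

lemma crux_orders_nonempty:
  assumes "simple_graph G" "verts G \<noteq> {}" "\<alpha> < 1"
  shows "{card (verts H) | H. is_crux \<alpha> G H} \<noteq> {}"
proof -
  have "0 \<le> avg_degree G" by (simp add: avg_degree_def)
  then have "\<alpha> * avg_degree G \<le> avg_degree G"
    using assms(3) by (simp add: mult_left_le_one_le mult_right_mono[of \<alpha> 1, simplified])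
  then have "is_crux \<alpha> G G" using assms by (simp add: is_crux_def subgraph_def)
  then show ?thesis by blast
qed

end

theory Submission
  imports Defs
begin

text \<open>
  Let \<open>S\<close> be a minimal nonempty vertex set whose induced subgraph is at least as dense as \<open>G\<close>. If
  \<open>W \<subseteq> S\<close> has size of order \<open>c = c\<^sub>\<alpha>(G)\<close> and few neighbours, then \<open>W\<close> together with its
  neighbourhood has fewer than \<open>c\<close> vertices, so it is sparse and deleting \<open>W\<close> would not lower the
  density; hence all such \<open>W\<close> have a neighbourhood of order \<open>(1 - \<alpha>) c\<close>. By an argument in the spirit of
  depth-first search there are a path \<open>Q\<close> and a set \<open>W\<close> of size of order \<open>c\<close> all of whose neighbours
  lie on \<open>Q\<close> and which is reachable from the end of \<open>Q\<close>. Closing up the path through \<open>W\<close> back to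
  the first neighbour of \<open>W\<close> on \<open>Q\<close> yields the cycle.
\<close>

section \<open>Neighbourhoods and reachability inside a vertex set\<close>

definition nbhd :: "('a \<Rightarrow> 'a \<Rightarrow> bool) \<Rightarrow> 'a set \<Rightarrow> 'a set \<Rightarrow> 'a set" where
  "nbhd E S W = {x \<in> S - W. \<exists>w\<in>W. E x w}"

text \<open>The start \<open>v\<close> stays out of \<open>ps\<close> because in use it lies outside
  \<open>U\<close>: it is the end of the search path or a vertex just taken from \<open>U\<close>.
  Distinctness allows appending \<open>ps\<close> to a path that avoids \<open>U\<close>.\<close>

definition reaches_within :: "('a \<Rightarrow> 'a \<Rightarrow> bool) \<Rightarrow> 'a set \<Rightarrow> 'a \<Rightarrow> 'a \<Rightarrow> bool" where
  "reaches_within E U v w \<longleftrightarrow>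
     (\<exists>ps. ps \<noteq> [] \<and> distinct ps \<and> set ps \<subseteq> U \<and> last ps = w \<and> successively E (v # ps))"

text \<open>A path that already visits \<open>x\<close> is cut off there; otherwise \<open>x\<close>
  is appended. Either way the vertices stay distinct.\<close>

lemma reaches_within_step:
  assumes "reaches_within E U v w" "E w x" "x \<in> U"
  shows "reaches_within E U v x"
proof -
  obtain ps where ps: "ps \<noteq> []" "distinct ps" "set ps \<subseteq> U" "last ps = w" "successively E (v # ps)"
    using assms(1) unfolding reaches_within_def by blast
  show ?thesis
  proof (cases "x \<in> set ps")
    case True
    then obtain ys zs where "ps = ys @ x # zs"
      by (meson split_list)
    then have "distinct (ys @ [x]) \<and> set (ys @ [x]) \<subseteq> U \<and> successively E (v # ys @ [x])"
      using ps by (auto simp: successively_append_iff successively_Cons hd_append split: if_splits)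
    then show ?thesis unfolding reaches_within_def
      by (intro exI[of _ "ys @ [x]"]) auto
  next
    case False
    then show ?thesis unfolding reaches_within_def
      using ps assms by (intro exI[of _ "ps @ [x]"]) (auto simp: successively_append_iff successively_Cons)
  qed
qed

text \<open>Trace the path backwards from its last vertex: since no edge leads from \<open>B\<close>
  to \<open>A\<close>, every predecessor of a vertex in \<open>A\<close> is again in
  \<open>A\<close>.\<close>

lemma successively_in_closed_part:
  assumes "successively E ps" "set ps \<subseteq> A \<union> B" "ps \<noteq> []" "last ps \<in> A"
    and "\<And>a b. a \<in> A \<Longrightarrow> b \<in> B \<Longrightarrow> \<not> E b a"
  shows "set ps \<subseteq> A"
  using assms(1-4)
proof (induction ps)
  case (Cons p ps)
  show ?case
  proof (cases ps)
    case Nil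
    then show ?thesis using Cons by simp
  next
    case (Cons q qs)
    then have "set ps \<subseteq> A" using Cons.IH Cons.prems by (auto simp: successively_Cons)
    then show ?thesis using Cons Cons.prems assms(5) by auto
  qed
qed simp

lemma reaches_within_part:
  assumes "reaches_within E (A \<union> B) v w" "w \<in> A"
    and "\<And>a b. a \<in> A \<Longrightarrow> b \<in> B \<Longrightarrow> \<not> E b a"
  shows "reaches_within E A v w"
proof -
  obtain ps where ps: "ps \<noteq> []" "distinct ps" "set ps \<subseteq> A \<union> B" "last ps = w"
      "successively E (v # ps)"
    using assms(1) unfolding reaches_within_def by blast
  then have "set ps \<subseteq> A"
    using successively_in_closed_part[of E ps A B] assms(2,3) by (auto simp: successively_Cons)
  then show ?thesis using ps unfolding reaches_within_def by blast
qed

section \<open>Search states and the cycle closed from them\<close>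

text \<open>\<open>Q\<close> is the current search path and \<open>U\<close> the set still in play;
  vertices of \<open>S\<close> in neither have been discarded. Reachability is demanded only for
  nonempty \<open>Q\<close>, so that \<open>Q = []\<close>, \<open>U = S\<close> is a state even if
  \<open>S\<close> is disconnected.\<close>

definition dfs_state :: "('a \<Rightarrow> 'a \<Rightarrow> bool) \<Rightarrow> 'a set \<Rightarrow> 'a list \<Rightarrow> 'a set \<Rightarrow> bool" where
  "dfs_state E S Q U \<longleftrightarrow>
     U \<subseteq> S \<and> set Q \<subseteq> S - U \<and> distinct Q \<and> successively E Q \<and> nbhd E S U \<subseteq> set Q \<and>
     (Q \<noteq> [] \<longrightarrow> (\<forall>w\<in>U. reaches_within E U (last Q) w))"

text \<open>This permits discarding \<open>B\<close> without touching the path: no vertex of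
  \<open>B\<close> becomes a neighbour of \<open>A\<close>, and paths that end in \<open>A\<close>
  never visit \<open>B\<close>.\<close>

lemma dfs_state_part:
  assumes "dfs_state E S Q (A \<union> B)"
    and "\<And>a b. a \<in> A \<Longrightarrow> b \<in> B \<Longrightarrow> \<not> E b a"
  shows "dfs_state E S Q A"
proof -
  have "nbhd E S A \<subseteq> nbhd E S (A \<union> B)"
    using assms(2) unfolding nbhd_def by blast
  moreover have "reaches_within E A (last Q) w" if "Q \<noteq> []" "w \<in> A" for w
    using that assms reaches_within_part[of E A B "last Q" w] unfolding dfs_state_def by blast
  ultimately show ?thesis using assms(1) unfolding dfs_state_def by blast
qed

text \<open>The only neighbour that \<open>U - {u}\<close> can gain is \<open>u\<close>, which now
  lies on the path.\<close>

lemma dfs_state_push: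
  assumes st: "dfs_state E S Q U" and u: "u \<in> U" "Q \<noteq> [] \<Longrightarrow> E (last Q) u"
    and reach: "\<And>w. w \<in> U - {u} \<Longrightarrow> reaches_within E (U - {u}) u w"
  shows "dfs_state E S (Q @ [u]) (U - {u})"
proof -
  have "nbhd E S (U - {u}) \<subseteq> insert u (nbhd E S U)"
    unfolding nbhd_def by blast
  then show ?thesis
    using assms unfolding dfs_state_def by (auto simp: successively_append_iff)
qed

text \<open>If \<open>U\<close> is connected, one vertex moves from \<open>U\<close> to the path.
  Otherwise \<open>U\<close> splits into two parts with no edges between them, and the larger one,
  having at least half of more than \<open>2 * m\<close> vertices, is kept.\<close>

lemma dfs_state_shrink:
  fixes E :: "'a \<Rightarrow> 'a \<Rightarrow> bool"
  assumes sym: "\<And>x y. E x y \<Longrightarrow> E y x" and "finite U"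
    and st: "dfs_state E S Q U" and big: "2 * m < card U"
  obtains Q' U' where "dfs_state E S Q' U'" "U' \<subset> U" "m \<le> card U'"
proof -
  have "\<exists>u\<in>U. Q \<noteq> [] \<longrightarrow> E (last Q) u"
  proof -
    obtain w where w: "w \<in> U" using big by fastforce
    show ?thesis
    proof (cases "Q = []")
      case False
      then obtain ps where ps: "ps \<noteq> []" "set ps \<subseteq> U" "successively E (last Q # ps)"
        using st w unfolding dfs_state_def reaches_within_def by blast
      then have "hd ps \<in> U" "E (last Q) (hd ps)" by (auto simp: successively_Cons)
      then show ?thesis by blast
    qed (use w in blast)
  qed
  then obtain u where u: "u \<in> U" "Q \<noteq> [] \<Longrightarrow> E (last Q) u" by blast
  \<comment> \<open>By symmetry \<open>A\<close> is the component of \<open>u\<close> in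
    \<open>U\<close>. The paths avoid \<open>u\<close>, so they remain valid once \<open>u\<close>
    is the new end of the search path.\<close>
  define A where "A = insert u {w \<in> U - {u}. reaches_within E (U - {u}) u w}"
  define B where "B = U - A"
  have AB: "U = A \<union> B" "A \<inter> B = {}" and "u \<in> A" using u by (auto simp: A_def B_def)
  show ?thesis
  proof (cases "B = {}")
    case True
    then have "reaches_within E (U - {u}) u w" if "w \<in> U - {u}" for w
      using that by (auto simp: A_def B_def)
    from dfs_state_push[OF st u this] have "dfs_state E S (Q @ [u]) (U - {u})" by blast
    moreover have "m \<le> card (U - {u})" using big u \<open>finite U\<close> by simp
    ultimately show ?thesis using that[of "Q @ [u]" "U - {u}"] u by blast
  next
    case False
    have no_edge: "\<not> E a b" if "a \<in> A" "b \<in> B" for a b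
    proof
      assume "E a b"
      have b: "b \<in> U - {u}" "b \<notin> A" using that \<open>u \<in> A\<close> by (auto simp: B_def)
      have "reaches_within E (U - {u}) u b"
      proof (cases "a = u")
        case True
        then show ?thesis unfolding reaches_within_def
          using b \<open>E a b\<close> by (intro exI[of _ "[b]"]) auto
      next
        case False
        then show ?thesis
          using reaches_within_step[of E "U - {u}" u a b] that b \<open>E a b\<close> by (auto simp: A_def)
      qed
      then show False using b by (simp add: A_def)
    qed
    have "dfs_state E S Q A"
      using dfs_state_part[of E S Q A B] st no_edge sym AB by blast
    moreover have "dfs_state E S Q B"
      using dfs_state_part[of E S Q B A] st no_edge sym AB by (metis Un_commute)
    moreover have "card U = card A + card B"
      using AB \<open>finite U\<close> by (metis card_Un_disjoint finite_Un)
    then have "m \<le> card A \<or> m \<le> card B" using big by linarith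
    moreover have "A \<subset> U" "B \<subset> U" using AB False \<open>u \<in> A\<close> by auto
    ultimately show ?thesis using that by blast
  qed
qed

text \<open>Shrinking is strict and never goes below \<open>m\<close>, so it can be repeated until
  the size is at most \<open>2 * m\<close>.\<close>

lemma dfs_state_of_size:
  fixes E :: "'a \<Rightarrow> 'a \<Rightarrow> bool"
  assumes sym: "\<And>x y. E x y \<Longrightarrow> E y x"
    and "finite U" "dfs_state E S Q U" "m \<le> card U"
  shows "\<exists>Q' U'. dfs_state E S Q' U' \<and> m \<le> card U' \<and> card U' \<le> 2 * m"
  using assms(2-)
proof (induction U arbitrary: Q rule: finite_psubset_induct)
  case (psubset U)
  show ?case
  proof (cases "card U \<le> 2 * m")
    case False
    then obtain Q' U' where "dfs_state E S Q' U'" "U' \<subset> U" "m \<le> card U'"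
      using dfs_state_shrink[of E U S Q m] sym psubset by (metis not_le)
    then show ?thesis using psubset.IH by blast
  qed (use psubset in blast)
qed

lemma long_cycle_of_local_expansion:
  fixes E :: "'a \<Rightarrow> 'a \<Rightarrow> bool"
  assumes sym: "\<And>x y. E x y \<Longrightarrow> E y x" and "finite S" "m \<le> card S" "0 < t"
    and expand: "\<And>W. W \<subseteq> S \<Longrightarrow> m \<le> card W \<Longrightarrow> card W \<le> 2 * m \<Longrightarrow> t \<le> card (nbhd E S W)"
  obtains C where "distinct C" "set C \<subseteq> S" "successively E C" "E (last C) (hd C)" "t < length C"
proof -
  have "dfs_state E S [] S" by (auto simp: dfs_state_def nbhd_def)
  then obtain Q U where st: "dfs_state E S Q U" and U: "m \<le> card U" "card U \<le> 2 * m"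
    using dfs_state_of_size[of E S S "[]" m] sym \<open>finite S\<close> \<open>m \<le> card S\<close> by blast
  note st' = st[unfolded dfs_state_def]
  have t: "t \<le> card (nbhd E S U)" using expand U st' by blast
  then obtain y where "y \<in> nbhd E S U" using \<open>0 < t\<close> by fastforce
  then have "\<exists>x\<in>set Q. x \<in> nbhd E S U" using st' by blast
  \<comment> \<open>As \<open>x\<close> is the first neighbour of \<open>U\<close> on
    \<open>Q\<close>, the segment \<open>x # zs\<close> contains all of \<open>nbhd E S U\<close>,
    hence at least \<open>t\<close> vertices. The nonempty detour \<open>ps\<close> through
    \<open>U\<close> makes the final inequality strict.\<close>
  then obtain ys x zs where Q: "Q = ys @ x # zs" "x \<in> nbhd E S U"
      "\<forall>y\<in>set ys. y \<notin> nbhd E S U"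
    using split_list_first_prop[of Q "\<lambda>x. x \<in> nbhd E S U"] by blast
  obtain w where w: "w \<in> U" "E x w" using Q(2) by (auto simp: nbhd_def)
  obtain ps where ps: "ps \<noteq> []" "distinct ps" "set ps \<subseteq> U" "last ps = w"
      "successively E (last Q # ps)"
    using st' w(1) Q(1) unfolding reaches_within_def by blast
  have "nbhd E S U \<subseteq> set (x # zs)" using st' Q by auto
  then have "card (nbhd E S U) \<le> length (x # zs)"
    by (meson List.finite_set card_length card_mono order_trans)
  then have "t \<le> length (x # zs)" using t by linarith
  show ?thesis
  proof (rule that[of "(x # zs) @ ps"])
    show "distinct ((x # zs) @ ps)" "set ((x # zs) @ ps) \<subseteq> S"
      using st' ps Q(1) by auto
    show "successively E ((x # zs) @ ps)"
      using st' ps Q(1) by (subst successively_append_iff) (auto simp: successively_append_iff successively_Cons)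
    show "E (last ((x # zs) @ ps)) (hd ((x # zs) @ ps))"
      using ps w sym by simp
    show "t < length ((x # zs) @ ps)"
      using \<open>t \<le> length (x # zs)\<close> ps(1) by (cases ps) auto
  qed
qed

lemma is_cycleI:
  assumes "distinct C" "set C \<subseteq> verts G" "3 \<le> length C"
    and "successively (\<lambda>x y. {x, y} \<in> edges G) C" "{last C, hd C} \<in> edges G"
  shows "is_cycle G C"
proof -
  have "{C ! i, C ! (Suc i mod length C)} \<in> edges G" if "i < length C" for i
  proof (cases "Suc i < length C")
    case True
    then show ?thesis using assms(4) by (simp add: successively_conv_nth)
  next
    case False
    then have "i = length C - 1" "Suc i = length C" "C \<noteq> []" using that by auto
    then show ?thesis using assms(5) by (simp add: last_conv_nth hd_conv_nth)
  qed
  then show ?thesis using assms by (simp add: is_cycle_def)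
qed

section \<open>Edge counts and expansion below the crux order\<close>

definition induced_edges :: "'a ugraph \<Rightarrow> 'a set \<Rightarrow> 'a set set" where
  "induced_edges G S = {e \<in> edges G. e \<subseteq> S}"

lemma finite_edges: "simple_graph G \<Longrightarrow> finite (edges G)"
  unfolding simple_graph_def by (rule finite_subset[of _ "Pow (verts G)"]) auto

text \<open>Otherwise \<open>S\<close> with its induced edges would be a crux of order below the
  minimum.\<close>

lemma card_induced_edges_small:
  assumes "simple_graph G" "S \<subseteq> verts G" "S \<noteq> {}" "card S < crux \<alpha> G"
  shows "2 * real (card (induced_edges G S)) < \<alpha> * avg_degree G * real (card S)"
proof (rule ccontr)
  assume neg: "\<not> ?thesis"
  have "finite S" using assms unfolding simple_graph_def by (meson finite_subset)
  then have "0 < card S" using assms(3) by (simp add: card_gt_0_iff)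
  then have "is_crux \<alpha> G (S, induced_edges G S)"
    using assms neg \<open>finite S\<close>
    by (auto simp: is_crux_def subgraph_def simple_graph_def avg_degree_def induced_edges_def
        pos_le_divide_eq)
  then have "card S \<in> {card (verts H) | H. is_crux \<alpha> G H}" by force
  then have "crux \<alpha> G \<le> card S"
    unfolding crux_def using crux_orders_finite[OF assms(1)] Min_le by blast
  then show False using assms(4) by simp
qed

text \<open>An edge inside \<open>S\<close> that meets \<open>W\<close> has its other end in
  \<open>W\<close> or in the neighbourhood of \<open>W\<close>.\<close>

lemma card_induced_edges_delete:
  assumes "simple_graph G" "S \<subseteq> verts G" "W \<subseteq> S"
  shows "card (induced_edges G S) \<le> card (induced_edges G (S - W)) +
           card (induced_edges G (W \<union> nbhd (\<lambda>x y. {x, y} \<in> edges G) S W))"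
proof -
  have "induced_edges G S \<subseteq> induced_edges G (S - W) \<union>
      induced_edges G (W \<union> nbhd (\<lambda>x y. {x, y} \<in> edges G) S W)" (is "_ \<subseteq> ?L \<union> ?R")
  proof
    fix e assume e: "e \<in> induced_edges G S"
    then have "card e = 2" using assms(1) by (auto simp: simple_graph_def induced_edges_def)
    then obtain a b where "e = {a, b}" by (auto simp: card_2_iff)
    moreover have "{b, a} = {a, b}" by blast
    ultimately show "e \<in> ?L \<union> ?R" using e by (fastforce simp: induced_edges_def nbhd_def)
  qed
  moreover have "finite (induced_edges G X)" for X
    using finite_edges[OF assms(1)] by (simp add: induced_edges_def)
  ultimately show ?thesis
    by (meson card_Un_le card_mono finite_UnI order_trans)
qed

lemma ex_minimal_dense_set:
  assumes "simple_graph G" "verts G \<noteq> {}"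
  obtains S where "S \<subseteq> verts G" "S \<noteq> {}"
    "avg_degree G * real (card S) \<le> 2 * real (card (induced_edges G S))"
    "\<And>T. T \<subset> S \<Longrightarrow> T \<noteq> {} \<Longrightarrow> 2 * real (card (induced_edges G T)) < avg_degree G * real (card T)"
proof -
  define F where "F = {S. S \<subseteq> verts G \<and> S \<noteq> {} \<and>
    avg_degree G * real (card S) \<le> 2 * real (card (induced_edges G S))}"
  have fin: "finite (verts G)" using assms(1) by (simp add: simple_graph_def)
  have "induced_edges G (verts G) = edges G"
    using assms(1) by (auto simp: induced_edges_def simple_graph_def)
  then have "verts G \<in> F" using assms(2) fin by (simp add: F_def avg_degree_def)
  moreover have "finite F" using fin by (auto simp: F_def intro: finite_subset[of _ "Pow (verts G)"])
  ultimately obtain S where S: "S \<in> F" "\<And>T. T \<in> F \<Longrightarrow> T \<subseteq> S \<Longrightarrow> T = S"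
    using finite_has_minimal[of F] by (metis empty_iff)
  show ?thesis
  proof (rule that[of S])
    fix T assume T: "T \<subset> S" "T \<noteq> {}"
    then have "T \<notin> F" using S(2) by blast
    then show "2 * real (card (induced_edges G T)) < avg_degree G * real (card T)"
      using T S(1) by (auto simp: F_def)
  qed (use S(1) in \<open>auto simp: F_def\<close>)
qed

text \<open>The bound on \<open>2 * m + t\<close> keeps \<open>W\<close> with a neighbourhood
  smaller than \<open>t\<close> below the crux order. The bound on \<open>t\<close> makes the
  \<alpha>-sparse edge count there less than the share of \<open>W\<close> in the density of
  \<open>S\<close>, so \<open>S - W\<close> would contradict minimality.\<close>

lemma ex_locally_expanding_set:
  fixes G :: "'a ugraph"
  assumes G: "simple_graph G" "edges G \<noteq> {}" and \<alpha>: "0 < \<alpha>" "\<alpha> < 1"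
    and m: "0 < m" "2 * m + t \<le> crux \<alpha> G" and t: "real t \<le> (1 - \<alpha>) * real m"
  obtains S where "S \<subseteq> verts G" "crux \<alpha> G \<le> card S"
    "\<And>W. W \<subseteq> S \<Longrightarrow> m \<le> card W \<Longrightarrow> card W \<le> 2 * m \<Longrightarrow>
      t \<le> card (nbhd (\<lambda>x y. {x, y} \<in> edges G) S W)"
proof -
  let ?N = "nbhd (\<lambda>x y. {x, y} \<in> edges G)"
  let ?d = "avg_degree G"
  have V: "finite (verts G)" "verts G \<noteq> {}" using G by (auto simp: simple_graph_def)
  have d: "0 < ?d"
    using G V finite_edges[OF G(1)] by (simp add: avg_degree_def card_gt_0_iff)
  obtain S where S: "S \<subseteq> verts G" "S \<noteq> {}"
      "?d * real (card S) \<le> 2 * real (card (induced_edges G S))"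
      "\<And>T. T \<subset> S \<Longrightarrow> T \<noteq> {} \<Longrightarrow> 2 * real (card (induced_edges G T)) < ?d * real (card T)"
    using ex_minimal_dense_set[OF G(1) V(2)] by blast
  have fin: "finite S" using S(1) V(1) finite_subset by blast
  have cS: "crux \<alpha> G \<le> card S"
  proof (rule ccontr)
    assume "\<not> ?thesis"
    then have "2 * real (card (induced_edges G S)) < \<alpha> * (?d * real (card S))"
      using card_induced_edges_small[OF G(1) S(1,2), of \<alpha>] by (simp add: mult.assoc)
    also have "\<dots> \<le> ?d * real (card S)"
      using \<alpha> d by (intro mult_left_le_one_le) auto
    finally show False using S(3) by simp
  qed
  show ?thesis
  proof (rule that[OF S(1) cS], rule ccontr)
    fix W assume W: "W \<subseteq> S" "m \<le> card W" "card W \<le> 2 * m" and "\<not> t \<le> card (?N S W)"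
    then have N: "card (?N S W) < t" by simp
    have finW: "finite W" "finite (?N S W)"
      using fin W(1) finite_subset by (auto simp: nbhd_def)
    have disj: "W \<inter> ?N S W = {}" by (auto simp: nbhd_def)
    have cWN: "card (W \<union> ?N S W) = card W + card (?N S W)"
      using finW disj by (simp add: card_Un_disjoint)
    have "W \<noteq> {}" using W(2) m(1) by auto
    have sub: "W \<union> ?N S W \<subseteq> verts G" using W(1) S(1) by (auto simp: nbhd_def)
    \<comment> \<open>Minimality speaks of nonempty sets only; here \<open>card W\<close> is at most
      \<open>2 * m\<close>, which is less than the crux order since \<open>0 < t\<close>.\<close>
    have "W \<noteq> S" using W(3) N m(2) cS by auto
    then have "2 * real (card (induced_edges G (S - W))) < ?d * real (card (S - W))"
      using S(4)[of "S - W"] W(1) \<open>W \<noteq> {}\<close> by blast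
    moreover have "2 * real (card (induced_edges G (W \<union> ?N S W))) < ?d * real (card W)"
    proof -
      have "2 * real (card (induced_edges G (W \<union> ?N S W)))
          < ?d * (\<alpha> * (real (card W) + real (card (?N S W))))"
        using card_induced_edges_small[OF G(1) sub, of \<alpha>] cWN W(3) N m(2) \<open>W \<noteq> {}\<close>
        by (simp add: mult_ac)
      also have "\<dots> \<le> ?d * real (card W)"
      proof (rule mult_left_mono)
        have "\<alpha> * real (card (?N S W)) \<le> real t"
          using \<alpha> N mult_left_le_one_le[of "real (card (?N S W))" \<alpha>] by simp
        also have "\<dots> \<le> (1 - \<alpha>) * real m" by (rule t)
        also have "\<dots> \<le> (1 - \<alpha>) * real (card W)"
          using W(2) \<alpha> by (intro mult_left_mono) auto
        finally show "\<alpha> * (real (card W) + real (card (?N S W))) \<le> real (card W)"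
          by (simp add: algebra_simps)
      qed (use d in simp)
      finally show ?thesis .
    qed
    moreover have "real (card (induced_edges G S)) \<le> real (card (induced_edges G (S - W))) +
        real (card (induced_edges G (W \<union> ?N S W)))"
      using card_induced_edges_delete[OF G(1) S(1) W(1)] by linarith
    moreover have "?d * real (card S) = ?d * real (card (S - W)) + ?d * real (card W)"
      using W(1) fin finW card_mono[OF fin W(1)]
      by (simp add: card_Diff_subset algebra_simps)
    ultimately show False using S(3) by linarith
  qed
qed

section \<open>Choice of the parameters\<close>

theorem theorem1p3:
  fixes G :: "'a ugraph" and \<alpha> :: real
  assumes "0 < \<alpha>" and "\<alpha> < 1"
    and "simple_graph G"
    and "\<exists>C. is_cycle G C"
  shows "\<exists>C. is_cycle G C \<and> real (length C) \<ge> (1 - \<alpha>) / 16000 * real (crux \<alpha> G)"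
proof -
  define c where "c = crux \<alpha> G"
  define b where "b = (1 - \<alpha>) * real c"
  obtain C\<^sub>0 where C\<^sub>0: "is_cycle G C\<^sub>0" using assms(4) by blast
  then have "3 \<le> length C\<^sub>0" by (simp add: is_cycle_def)
  \<comment> \<open>A bound of at most 3 is met by any cycle. Otherwise \<open>b\<close> exceeds
    48000, which absorbs all rounding errors below.\<close>
  show ?thesis
  proof (cases "b / 16000 \<le> 3")
    case True
    then show ?thesis using C\<^sub>0 \<open>3 \<le> length C\<^sub>0\<close> by (auto simp: b_def c_def)
  next
    case False
    \<comment> \<open>With \<open>m\<close> about \<open>c / 4\<close>, sets of up to
      \<open>2 * m\<close> vertices fill at most half of the crux order and leave room for
      \<open>t\<close>.\<close>
    define m where "m = c div 4"
    define t where "t = nat \<lceil>b / 16000\<rceil>"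
    have "b \<le> real c" using assms(1) by (simp add: b_def mult_left_le_one_le algebra_simps)
    have tb: "b / 16000 \<le> real t" "real t < b / 16000 + 1"
      using False unfolding t_def by linarith+
    have "3 < t" using tb(1) False by linarith
    have rm: "real c \<le> 4 * real m + 3" unfolding m_def by linarith
    have "0 < m" using False \<open>b \<le> real c\<close> rm by linarith
    have "4 * m \<le> c" by (simp add: m_def)
    moreover have "4 * real t \<le> real c" using tb(2) False \<open>b \<le> real c\<close> by linarith
    ultimately have size: "2 * m + t \<le> crux \<alpha> G" unfolding c_def by linarith
    \<comment> \<open>This gives \<open>(1 - \<alpha>) * m\<close> at least
      \<open>(b - 3) / 4\<close>, well above \<open>b / 16000 + 1\<close> and hence above
      \<open>t\<close>.\<close>
    have "b \<le> (1 - \<alpha>) * (4 * real m + 3)"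
      unfolding b_def using rm assms(2) by (intro mult_left_mono) auto
    then have "b \<le> 4 * ((1 - \<alpha>) * real m) + 3"
      using assms(1) by (simp add: algebra_simps)
    then have "real t \<le> (1 - \<alpha>) * real m" using tb(2) False by linarith
    moreover have "edges G \<noteq> {}"
      using C\<^sub>0 unfolding is_cycle_def by fastforce
    ultimately obtain S where S: "S \<subseteq> verts G" "crux \<alpha> G \<le> card S"
        "\<And>W. W \<subseteq> S \<Longrightarrow> m \<le> card W \<Longrightarrow> card W \<le> 2 * m \<Longrightarrow>
          t \<le> card (nbhd (\<lambda>x y. {x, y} \<in> edges G) S W)"
      using ex_locally_expanding_set[OF assms(3) _ assms(1,2) \<open>0 < m\<close> size] by blast
    have "finite S" using S(1) assms(3) finite_subset by (auto simp: simple_graph_def)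
    moreover have "m \<le> card S" using S(2) size by linarith
    ultimately obtain C where C: "distinct C" "set C \<subseteq> S"
        "successively (\<lambda>x y. {x, y} \<in> edges G) C" "{last C, hd C} \<in> edges G" "t < length C"
      using long_cycle_of_local_expansion[of "\<lambda>x y. {x, y} \<in> edges G" S m t] S(3) \<open>3 < t\<close>
      by (auto simp: insert_commute)
    then have "is_cycle G C" using S(1) \<open>3 < t\<close> by (intro is_cycleI) auto
    moreover have "(1 - \<alpha>) / 16000 * real (crux \<alpha> G) \<le> real (length C)"
      using tb(1) C(5) by (simp add: b_def c_def)
    ultimately show ?thesis by blast
  qed
qed

end
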